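(* Let $d\ge 2$. The map $T\mapsto\{h(e):e\in T\}$ is a bijection from the set $\Theta$ of tilings to the set of perfect matchings of the hypergraph $(U^d,H^d)$.
   Context: Fix an integer $d\ge 2$. Let $\mathbf e_1,\dots,\mathbf e_{d+1}$ be the standard basis of $\mathbb R^{d+1}$, $\mathbf n=\mathbf e_1+\dots+\mathbf e_{d+1}$, $H=\mathbf n^\perp\subset\mathbb R^{d+1}$, $P$ the orthogonal projection onto $H$, and $\mathbf g_i=P\mathbf e_i=\mathbf e_i-\mathbf n/(d+1)$. The simplicial lattice $(X^d,E^d)$ is the graph with vertex set $X^d=P(\mathbb Z^{d+1})\subset H$ (equivalently $\mathbb Z^{d+1}/\mathbb Z\mathbf n$) and edges $\{\mathbf x,\mathbf x+\mathbf g_i\}$, $\mathbf x\in X^d$, $1\le i\le d+1$. A (rooted) simplicial loop is a closed path $(\mathbf s_k)_{0\le k\le d+1}$ in $X^d$ with $\mathbf s_k=\mathbf s_{k-1}+\mathbf g_{\xi(k)}$ for some permutation $\xi$ of $\{1,\dots,d+1\}$. Two rooted loops define the same unrooted simplicial loop if they are equal up to cyclic re-indexing (equivalently, traverse the same set of edges). $U^d$ is the set of unrooted simplicial loops. A tiling is a set $T\subset E^d$ containing exactly one edge of every simplicial loop; $\Theta$ is the set of tilings. For $e\in E^d$, $h(e)\subset U^d$ is the set of unrooted simplicial loops that traverse $e$; $H^d:=\{h(e):e\in E^d\}$. A perfect matching of the hypergraph $(U^d,H^d)$ is a subset of the hyperedge set $H^d$ which forms a partition of the vertex set $U^d$. 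*)

theory Defs
  imports "HOL-Analysis.Analysis"
begin

text \<open>
  The ambient space of dimension d + 1 is \<^typ>\<open>real ^ 'n\<close> with CARD('n) = d + 1, so the finite type
  'n replaces the index set {1, ..., d+1}.
\<close>

definition nvec :: "real ^ 'n" where
  "nvec = (\<Sum>i\<in>UNIV. axis i 1)"

definition hyperplane :: "(real ^ 'n) set" where
  "hyperplane = orthogonal_comp {nvec}"

text \<open>Orthogonal projection onto \<^const>\<open>hyperplane\<close>; see \<open>projH_orthogonal_projection\<close> below.\<close>

definition projH :: "real ^ 'n \<Rightarrow> real ^ 'n" where
  "projH x = x - ((x \<bullet> nvec) / ((nvec :: real ^ 'n) \<bullet> nvec)) *\<^sub>R nvec"

definition gvec :: "'n \<Rightarrow> real ^ 'n" where
  "gvec i = projH (axis i 1)"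

definition lattice_vertices :: "(real ^ 'n) set" where
  "lattice_vertices = projH ` {z. \<forall>i. z $ i \<in> \<int>}"

definition lattice_edges :: "(real ^ 'n) set set" where
  "lattice_edges = {{x, x + gvec i} | x i. x \<in> lattice_vertices}"

text \<open>
  A path \<open>(s\<^sub>k)\<close>, 0 \<le> k \<le> d + 1, is a list of length d + 2. A permutation of the directions is a
  bijection from the step numbers 1, ..., d + 1 to the direction type 'n.
\<close>

definition rooted_loop :: "(real ^ 'n) list \<Rightarrow> bool" where
  "rooted_loop s \<longleftrightarrow>
     length s = CARD('n) + 1 \<and> set s \<subseteq> lattice_vertices \<and> s ! CARD('n) = s ! 0 \<and>
     (\<exists>\<xi> :: nat \<Rightarrow> 'n. bij_betw \<xi> {1..CARD('n)} UNIV \<and>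
        (\<forall>k\<in>{1..CARD('n)}. s ! k = s ! (k - 1) + gvec (\<xi> k)))"

definition cyclic_rel :: "((real ^ 'n) list \<times> (real ^ 'n) list) set" where
  "cyclic_rel = {(s, s'). rooted_loop s \<and> rooted_loop s' \<and>
     (\<exists>m. \<forall>k\<le>CARD('n). s' ! k = s ! ((k + m) mod CARD('n)))}"

definition unrooted_loops :: "(real ^ 'n) list set set" where
  "unrooted_loops = {s. rooted_loop s} // cyclic_rel"

definition path_edges :: "'a list \<Rightarrow> 'a set set" where
  "path_edges s = {{s ! k, s ! Suc k} | k. Suc k < length s}"

text \<open>The choice of the representative is immaterial; see \<open>path_edges_cyclic_rel\<close> below.\<close>

definition traverses :: "(real ^ 'n) list set \<Rightarrow> (real ^ 'n) set \<Rightarrow> bool" where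
  "traverses u e \<longleftrightarrow> (\<exists>s\<in>u. e \<in> path_edges s)"

definition tilings :: "(real ^ 'n) set set set" where
  "tilings = {T. T \<subseteq> lattice_edges \<and> (\<forall>u\<in>unrooted_loops. \<exists>!e. e \<in> T \<and> traverses u e)}"

definition loops_through :: "(real ^ 'n) set \<Rightarrow> (real ^ 'n) list set set" where
  "loops_through e = {u \<in> unrooted_loops. traverses u e}"

definition hyperedges :: "(real ^ 'n) list set set set" where
  "hyperedges = loops_through ` lattice_edges"

definition perfect_matching :: "'v set \<Rightarrow> 'v set set \<Rightarrow> 'v set set \<Rightarrow> bool" where
  "perfect_matching V F M \<longleftrightarrow> M \<subseteq> F \<and> partition_on V M"

lemma nvec_component [simp]: "nvec $ i = 1"
  by (simp add: nvec_def axis_def)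

lemma inner_nvec_nvec: "(nvec :: real ^ 'n) \<bullet> nvec = real CARD('n)"
  by (simp add: inner_vec_def)

lemma projH_orthogonal_projection:
  shows "projH x \<in> hyperplane" and "y \<in> hyperplane \<Longrightarrow> orthogonal (x - projH x) y"
proof -
  show "projH x \<in> hyperplane"
    by (simp add: projH_def hyperplane_def orthogonal_comp_def orthogonal_def inner_diff_right
        inner_nvec_nvec inner_commute[of x])
  show "orthogonal (x - projH x) y" if "y \<in> hyperplane"
    using that by (simp add: projH_def hyperplane_def orthogonal_comp_def orthogonal_def)
qed

lemma gvec_eq: "gvec i = axis i 1 - (1 / real CARD('n)) *\<^sub>R (nvec :: real ^ 'n)"
  by (simp add: gvec_def projH_def inner_nvec_nvec inner_axis')

lemma equiv_cyclic_rel: "equiv {s :: (real ^ 'n) list. rooted_loop s} cyclic_rel"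
proof (rule equivI)
  let ?n = "CARD('n)"
  have pos: "?n > 0" by simp
  show "cyclic_rel \<subseteq> {s :: (real ^ 'n) list. rooted_loop s} \<times> {s. rooted_loop s}"
    by (auto simp: cyclic_rel_def)
  show "refl_on {s :: (real ^ 'n) list. rooted_loop s} cyclic_rel"
  proof (rule refl_onI)
    fix s :: "(real ^ 'n) list" assume "s \<in> {s. rooted_loop s}"
    then have s: "rooted_loop s" by simp
    have "s ! k = s ! ((k + 0) mod ?n)" if "k \<le> ?n" for k
      using s that by (cases "k = ?n") (auto simp: rooted_loop_def)
    with s show "(s, s) \<in> cyclic_rel" unfolding cyclic_rel_def by blast
  qed
  show "sym (cyclic_rel :: ((real ^ 'n) list \<times> _) set)"
  proof (rule symI)
    fix s s' :: "(real ^ 'n) list" assume "(s, s') \<in> cyclic_rel"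
    then obtain m where s: "rooted_loop s" "rooted_loop s'"
      and m: "\<And>k. k \<le> ?n \<Longrightarrow> s' ! k = s ! ((k + m) mod ?n)"
      by (auto simp: cyclic_rel_def)
    have "s ! k = s' ! ((k + (?n - m mod ?n)) mod ?n)" if "k \<le> ?n" for k
    proof -
      have le: "m mod ?n \<le> ?n" by simp
      have "s' ! ((k + (?n - m mod ?n)) mod ?n)
          = s ! (((k + (?n - m mod ?n)) mod ?n + m) mod ?n)"
        by (rule m) simp
      also have "((k + (?n - m mod ?n)) mod ?n + m) mod ?n
          = (k + (?n - m mod ?n) + m mod ?n) mod ?n"
        by (metis mod_add_left_eq mod_add_right_eq)
      also have "k + (?n - m mod ?n) + m mod ?n = k + ?n" using le by linarith
      also have "(k + ?n) mod ?n = k mod ?n" by simp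
      also have "s ! (k mod ?n) = s ! k"
        using s(1) that by (cases "k = ?n") (auto simp: rooted_loop_def)
      finally show ?thesis by simp
    qed
    with s show "(s', s) \<in> cyclic_rel" unfolding cyclic_rel_def by blast
  qed
  show "trans (cyclic_rel :: ((real ^ 'n) list \<times> _) set)"
  proof (rule transI)
    fix s s' s'' :: "(real ^ 'n) list"
    assume "(s, s') \<in> cyclic_rel" "(s', s'') \<in> cyclic_rel"
    then obtain m m' where s: "rooted_loop s" "rooted_loop s''"
      and m: "\<And>k. k \<le> ?n \<Longrightarrow> s' ! k = s ! ((k + m) mod ?n)"
      and m': "\<And>k. k \<le> ?n \<Longrightarrow> s'' ! k = s' ! ((k + m') mod ?n)"
      by (auto simp: cyclic_rel_def)
    have "s'' ! k = s ! ((k + (m' + m)) mod ?n)" if "k \<le> ?n" for k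
      using m'[OF that] m[of "(k + m') mod ?n"] by (simp add: mod_simps add.assoc)
    with s show "(s, s'') \<in> cyclic_rel" unfolding cyclic_rel_def by blast
  qed
qed

lemma path_edges_cyclic_rel:
  assumes "(s, s') \<in> (cyclic_rel :: ((real ^ 'n) list \<times> _) set)"
  shows "path_edges s = path_edges s'"
proof -
  let ?n = "CARD('n)"
  have sub: "path_edges t' \<subseteq> path_edges t" if "(t, t') \<in> cyclic_rel" for t t' :: "(real ^ 'n) list"
  proof
    fix e assume "e \<in> path_edges t'"
    from that obtain m where t: "rooted_loop t" "rooted_loop t'"
      and m: "\<And>k. k \<le> ?n \<Longrightarrow> t' ! k = t ! ((k + m) mod ?n)"
      by (auto simp: cyclic_rel_def)
    from \<open>e \<in> path_edges t'\<close> t obtain k where k: "k < ?n" "e = {t' ! k, t' ! Suc k}"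
      by (auto simp: path_edges_def rooted_loop_def)
    define j where "j = (k + m) mod ?n"
    have j: "j < ?n" by (simp add: j_def)
    have "t' ! Suc k = t ! (Suc j mod ?n)"
      using m[of "Suc k"] k by (simp add: j_def mod_simps)
    also have "\<dots> = t ! Suc j"
      using j t(1) by (cases "Suc j = ?n") (auto simp: rooted_loop_def)
    finally have "e = {t ! j, t ! Suc j}" using k m[of k] by (simp add: j_def)
    with j t show "e \<in> path_edges t" by (auto simp: path_edges_def rooted_loop_def)
  qed
  have "(s', s) \<in> cyclic_rel" using assms equiv_cyclic_rel by (meson equivE symE)
  with sub assms show ?thesis by blast
qed

end

theory Submission
  imports Defs
begin

text \<open>
  It suffices that every \<open>h(e)\<close> is nonempty and that \<open>e \<mapsto> h(e)\<close> is injective. For the edge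
  from \<open>x\<close> to \<open>x + g\<^sub>i\<close>, take a loop that starts at \<open>x\<close> with direction \<open>i\<close> and a second one that
  takes the remaining directions in reverse order. The partial sums of the \<open>g\<^sub>j\<close> over proper
  subsets of the directions are pairwise distinct, so \<open>x\<close> and \<open>x + g\<^sub>i\<close> are the only vertices that
  the two loops share. Hence no other edge lies on both.
\<close>

section \<open>Lattice points and partial sums of the directions\<close>

lemma linear_projH: "linear (projH :: real ^ 'n \<Rightarrow> real ^ 'n)"
  by (rule linearI)
    (simp_all add: projH_def inner_add_left add_divide_distrib scaleR_add_left
      scaleR_diff_right algebra_simps)

lemma lattice_vertices_add_gvec:
  fixes x :: "real ^ 'n"
  assumes "x \<in> lattice_vertices"
  shows "x + gvec i \<in> lattice_vertices"
proof -
  obtain z where z: "x = projH z" "\<forall>i. z $ i \<in> \<int>"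
    using assms by (auto simp: lattice_vertices_def)
  have "x + gvec i = projH (z + axis i 1)"
    by (simp add: z gvec_def linear_add[OF linear_projH])
  moreover have "\<forall>j. (z + axis i 1) $ j \<in> \<int>"
    using z(2) by (auto simp: axis_def)
  ultimately show ?thesis
    unfolding lattice_vertices_def by blast
qed

lemma lattice_vertices_add_sum_gvec:
  fixes x :: "real ^ 'n"
  assumes "finite A" "x \<in> lattice_vertices"
  shows "x + sum gvec A \<in> lattice_vertices"
  using assms
proof (induction A rule: finite_induct)
  case (insert a A)
  then show ?case
    using lattice_vertices_add_gvec[of "x + sum gvec A" a] by (simp add: ac_simps)
qed simp

lemma sum_gvec_component:
  "sum gvec A $ i = of_bool (i \<in> A) - real (card A) / real CARD('n)"
  for A :: "'n::finite set"
proof -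
  have "(\<Sum>j\<in>A. axis j (1::real) $ i) = (\<Sum>j\<in>A. of_bool (j = i))"
    by (intro sum.cong) (auto simp: axis_def)
  also have "\<dots> = of_bool (i \<in> A)"
    by (simp add: of_bool_def)
  finally have axis: "(\<Sum>j\<in>A. axis j (1::real) $ i) = of_bool (i \<in> A)" .
  have "sum gvec A $ i = (\<Sum>j\<in>A. axis j 1 $ i - 1 / real CARD('n))"
    by (simp add: gvec_eq)
  then show ?thesis
    by (simp add: sum_subtractf axis)
qed

lemma sum_gvec_UNIV: "sum gvec UNIV = (0 :: real ^ 'n)"
  by (simp add: vec_eq_iff sum_gvec_component del: sum_component)

text \<open>Coordinatewise, the indicators of \<open>A\<close> and \<open>B\<close> differ by a
  constant \<open>c\<close>. Such a difference lies in {-1, 0, 1}: 0 forces equality, while 1 or -1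
  forces one set to be full and the other empty.\<close>

lemma sum_gvec_eq_iff:
  fixes A B :: "'n::finite set"
  shows "sum gvec A = (sum gvec B :: real ^ 'n) \<longleftrightarrow> A = B \<or> {A, B} = {{}, UNIV}"
proof
  assume eq: "sum gvec A = (sum gvec B :: real ^ 'n)"
  define c where "c = (real (card A) - real (card B)) / real CARD('n)"
  have c: "of_bool (i \<in> A) - of_bool (i \<in> B) = c" for i
    using arg_cong[OF eq, of "\<lambda>v. v $ i"]
    by (simp add: sum_gvec_component c_def diff_divide_distrib del: sum_component)
  \<comment> \<open>The index type is inhabited, so the arbitrary index \<open>undefined\<close>
    already restricts \<open>c\<close> to three values.\<close>
  consider "c = 0" | "c = 1" | "c = - 1"
    using c[of undefined] by (auto simp: of_bool_def split: if_splits)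
  then consider "\<forall>i. i \<in> A \<longleftrightarrow> i \<in> B" | "\<forall>i. i \<in> A \<and> i \<notin> B" | "\<forall>i. i \<notin> A \<and> i \<in> B"
    using c by cases (force simp: of_bool_def split: if_splits)+
  then show "A = B \<or> {A, B} = {{}, UNIV}"
    by cases auto
next
  assume "A = B \<or> {A, B} = {{}, UNIV}"
  then show "sum gvec A = (sum gvec B :: real ^ 'n)"
    by (auto simp: doubleton_eq_iff sum_gvec_UNIV)
qed

text \<open>With at least two directions, \<open>{i}\<close> is neither empty nor full. Consequently
  the two endpoints of an edge are distinct.\<close>

lemma gvec_nonzero:
  assumes "CARD('n) \<ge> 2"
  shows "gvec i \<noteq> (0 :: real ^ 'n)"
proof
  assume "gvec i = (0 :: real ^ 'n)"
  then have "sum gvec {i} = (sum gvec {} :: real ^ 'n)"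
    by simp
  then have "{i} = (UNIV :: 'n set)"
    unfolding sum_gvec_eq_iff doubleton_eq_iff by blast
  then have "CARD('n) = card {i}"
    by simp
  then show False
    using assms by simp
qed

section \<open>Loops from orderings of the directions\<close>

text \<open>The closed form shows that vertex \<open>k\<close> depends only on the set of the first
  \<open>k\<close> directions, so vertices can be compared through
  \<open>sum_gvec_eq_iff\<close>.\<close>

definition perm_loop :: "real ^ 'n \<Rightarrow> (nat \<Rightarrow> 'n) \<Rightarrow> (real ^ 'n) list" where
  "perm_loop x \<xi> = map (\<lambda>k. x + sum gvec (\<xi> ` {1..k})) [0..<Suc CARD('n)]"

lemma perm_loop_nth:
  "k \<le> CARD('n) \<Longrightarrow> perm_loop x \<xi> ! k = x + sum gvec (\<xi> ` {1..k})"
  for x :: "real ^ 'n"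
  unfolding perm_loop_def by (subst nth_map) (auto simp del: upt_Suc)

lemma rooted_loop_perm_loop:
  fixes x :: "real ^ 'n"
  assumes "x \<in> lattice_vertices" "bij_betw \<xi> {1..CARD('n)} UNIV"
  shows "rooted_loop (perm_loop x \<xi>)"
  unfolding rooted_loop_def
proof (intro conjI exI ballI)
  show "length (perm_loop x \<xi>) = CARD('n) + 1"
    by (simp add: perm_loop_def)
  show "set (perm_loop x \<xi>) \<subseteq> lattice_vertices"
    using assms(1) by (auto simp: perm_loop_def lattice_vertices_add_sum_gvec simp del: upt_Suc)
  show "perm_loop x \<xi> ! CARD('n) = perm_loop x \<xi> ! 0"
    using bij_betw_imp_surj_on[OF assms(2)] by (simp add: perm_loop_nth sum_gvec_UNIV)
  show "bij_betw \<xi> {1..CARD('n)} UNIV"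
    by fact
next
  fix k assume k: "k \<in> {1..CARD('n)}"
  then have "{1..k} = insert k {1..k - 1}"
    by auto
  \<comment> \<open>By injectivity the direction of step \<open>k\<close> is new, so the partial sum
    grows by exactly one \<open>gvec\<close>.\<close>
  moreover have "\<xi> k \<notin> \<xi> ` {1..k - 1}"
    using k inj_onD[OF bij_betw_imp_inj_on[OF assms(2)], of k] by fastforce
  ultimately have "sum gvec (\<xi> ` {1..k}) = gvec (\<xi> k) + (sum gvec (\<xi> ` {1..k - 1}) :: real ^ 'n)"
    by simp
  then show "perm_loop x \<xi> ! k = perm_loop x \<xi> ! (k - 1) + gvec (\<xi> k)"
    using k by (subst (1 2) perm_loop_nth) (auto simp: ac_simps)
qed

lemma first_edge_perm_loop:
  fixes x :: "real ^ 'n"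
  shows "{x, x + gvec (\<xi> 1)} \<in> path_edges (perm_loop x \<xi>)"
proof -
  have "{x, x + gvec (\<xi> 1)} = {perm_loop x \<xi> ! 0, perm_loop x \<xi> ! Suc 0}"
    by (simp add: perm_loop_nth Suc_leI)
  moreover have "Suc 0 < length (perm_loop x \<xi>)"
    by (simp add: perm_loop_def)
  ultimately show ?thesis
    unfolding path_edges_def by blast
qed

section \<open>Hyperedges tested on explicit loops\<close>

lemma path_edges_subset: "e \<in> path_edges s \<Longrightarrow> e \<subseteq> set s"
  by (auto simp: path_edges_def)

text \<open>Cyclic re-indexing preserves the edge set, so one representative decides
  traversal.\<close>

lemma traverses_class_iff:
  fixes s :: "(real ^ 'n) list"
  assumes "rooted_loop s"
  shows "traverses (cyclic_rel `` {s}) e \<longleftrightarrow> e \<in> path_edges s"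
proof -
  have "s \<in> cyclic_rel `` {s}"
    using assms equiv_class_self[OF equiv_cyclic_rel] by simp
  then show ?thesis
    unfolding traverses_def using path_edges_cyclic_rel by blast
qed

lemma class_in_loops_through_iff:
  fixes s :: "(real ^ 'n) list"
  assumes "rooted_loop s"
  shows "cyclic_rel `` {s} \<in> loops_through e \<longleftrightarrow> e \<in> path_edges s"
proof -
  have "cyclic_rel `` {s} \<in> unrooted_loops"
    unfolding unrooted_loops_def using assms by (intro quotientI) simp
  then show ?thesis
    by (simp add: loops_through_def traverses_class_iff[OF assms])
qed

section \<open>A second loop through the same edge\<close>

lemma ex_direction_order:
  "\<exists>\<xi>. bij_betw \<xi> {1..CARD('n)} UNIV \<and> \<xi> 1 = i" for i :: "'n::finite"
proof -
  obtain \<eta> :: "nat \<Rightarrow> 'n" where \<eta>: "bij_betw \<eta> {1..CARD('n)} UNIV"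
    using ex_bij_betw_nat_finite_1[OF finite[of UNIV]] by auto
  \<comment> \<open>Swapping \<open>i\<close> with the first direction of an arbitrary enumeration
    moves \<open>i\<close> to step 1.\<close>
  have "bij_betw (Transposition.transpose i (\<eta> 1) \<circ> \<eta>) {1..CARD('n)} UNIV"
    by (rule bij_betw_trans[OF \<eta>]) simp
  then show ?thesis
    by (intro exI[of _ "Transposition.transpose i (\<eta> 1) \<circ> \<eta>"]) simp
qed

text \<open>With at least two directions, this postpones \<open>\<xi> 2\<close> to the last step,
  which separates the two loops away from their common first edge.\<close>

definition rev_tail :: "(nat \<Rightarrow> 'n) \<Rightarrow> nat \<Rightarrow> 'n" where
  "rev_tail \<xi> k = (if k = 1 then \<xi> 1 else \<xi> (CARD('n) + 2 - k))"

lemma rev_tail_1 [simp]: "rev_tail \<xi> 1 = \<xi> 1"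
  by (simp add: rev_tail_def)

text \<open>The re-indexing of the steps is an involution, hence its own inverse.\<close>

lemma bij_betw_rev_tail:
  fixes \<xi> :: "nat \<Rightarrow> 'n::finite"
  assumes "bij_betw \<xi> {1..CARD('n)} UNIV"
  shows "bij_betw (rev_tail \<xi>) {1..CARD('n)} UNIV"
proof -
  let ?r = "\<lambda>k. if k = 1 then 1 else CARD('n) + 2 - k"
  have "bij_betw ?r {1..CARD('n)} {1..CARD('n)}"
  proof (rule bij_betw_byWitness[where f' = ?r])
    have r: "?r k \<in> {1..CARD('n)} \<and> ?r (?r k) = k" if "k \<in> {1..CARD('n)}" for k
      using that by (cases "k = 1") auto
    then show "\<forall>k\<in>{1..CARD('n)}. ?r (?r k) = k" "\<forall>k\<in>{1..CARD('n)}. ?r (?r k) = k"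
      by blast+
    show "?r ` {1..CARD('n)} \<subseteq> {1..CARD('n)}" "?r ` {1..CARD('n)} \<subseteq> {1..CARD('n)}"
      using r by blast+
  qed
  moreover have "rev_tail \<xi> = \<xi> \<circ> ?r"
    by (auto simp: rev_tail_def)
  ultimately show ?thesis
    using assms by (metis bij_betw_trans)
qed

text \<open>A shared vertex comes from equal sets of used directions, unless these are empty or full
  and give \<open>x\<close>. If such a set has size \<open>k\<close> with
  \<open>2 \<le> k < CARD('n)\<close>, it contains \<open>\<xi> 2\<close>, which the second loop
  uses only in its last step.\<close>

lemma common_vertices_rev_tail:
  fixes x :: "real ^ 'n"
  assumes bij: "bij_betw \<xi> {1..CARD('n)} UNIV"
  shows "set (perm_loop x \<xi>) \<inter> set (perm_loop x (rev_tail \<xi>)) \<subseteq> {x, x + gvec (\<xi> 1)}"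
proof
  let ?n = "CARD('n)"
  fix y assume "y \<in> set (perm_loop x \<xi>) \<inter> set (perm_loop x (rev_tail \<xi>))"
  then obtain k l where k: "k \<le> ?n" and yk: "y = x + sum gvec (\<xi> ` {1..k})"
    and l: "l \<le> ?n" and yl: "y = x + sum gvec (rev_tail \<xi> ` {1..l})"
    by (auto simp: perm_loop_def less_Suc_eq_le simp del: upt_Suc)
  note inj = bij_betw_imp_inj_on[OF bij]
    and inj' = bij_betw_imp_inj_on[OF bij_betw_rev_tail[OF bij]]
  \<comment> \<open>The first case covers \<open>k = 0\<close>, \<open>k = CARD('n)\<close> and the
    exceptional alternative of \<open>sum_gvec_eq_iff\<close>; each yields
    \<open>y = x\<close>.\<close>
  consider "\<xi> ` {1..k} \<in> {{}, UNIV}" | "k = 1"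
    | (mid) "k \<ge> 2" "k < ?n" "\<xi> ` {1..k} = rev_tail \<xi> ` {1..l}"
  proof -
    have "\<xi> ` {1..k} = UNIV" if "k = ?n"
      using that bij_betw_imp_surj_on[OF bij] by simp
    moreover have "\<xi> ` {1..k} = {}" if "k = 0"
      using that by simp
    moreover have "\<xi> ` {1..k} = rev_tail \<xi> ` {1..l} \<or> \<xi> ` {1..k} \<in> {{}, UNIV}"
    proof -
      have "sum gvec (\<xi> ` {1..k}) = (sum gvec (rev_tail \<xi> ` {1..l}) :: real ^ 'n)"
        using yk yl by simp
      then show ?thesis
        unfolding sum_gvec_eq_iff doubleton_eq_iff by blast
    qed
    ultimately show thesis
      using that k by (metis One_nat_def Suc_1 insertCI le_neq_implies_less less_Suc0 not_less_eq_eq)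
  qed
  then show "y \<in> {x, x + gvec (\<xi> 1)}"
  proof cases
    case 1
    then show ?thesis
      using yk by (auto simp: sum_gvec_UNIV)
  next
    case 2
    then show ?thesis
      using yk by simp
  next
    case mid
    have "card (\<xi> ` {1..k}) = k" "card (rev_tail \<xi> ` {1..l}) = l"
      using k l by (simp_all add: card_image inj_on_subset[OF inj] inj_on_subset[OF inj'])
    with mid have "l = k"
      by simp
    moreover have "\<xi> 2 \<in> \<xi> ` {1..k}"
      using mid(1) by simp
    ultimately have "\<xi> 2 \<in> rev_tail \<xi> ` {1..k}"
      using mid(3) by simp
    then obtain m where m: "1 \<le> m" "m \<le> k" "\<xi> 2 = rev_tail \<xi> m"
      by auto
    \<comment> \<open>The step at which \<open>\<xi>\<close> itself takes the direction
      \<open>rev_tail \<xi> m\<close>. Then \<open>j = 2\<close> means \<open>m = CARD('n)\<close>,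
      against \<open>m \<le> k < CARD('n)\<close>.\<close>
    define j where "j = (if m = 1 then 1 else ?n + 2 - m)"
    have "\<xi> 2 = \<xi> j" "j \<in> {1..?n}"
      using m mid(1,2) by (auto simp: j_def rev_tail_def)
    then have "j = 2"
      using inj_onD[OF inj, of 2 j] mid(1,2) by simp
    then show ?thesis
      using m(1,2) mid(2) by (simp add: j_def split: if_splits)
  qed
qed

section \<open>Nonemptiness and injectivity\<close>

text \<open>Any loop whose first step runs along \<open>e\<close> is a witness. This supplies the
  condition of \<open>partition_on\<close> that no block is empty.\<close>

lemma loops_through_nonempty:
  fixes e :: "(real ^ 'n) set"
  assumes "e \<in> lattice_edges"
  shows "loops_through e \<noteq> {}"
proof -
  obtain x i where x: "x \<in> lattice_vertices" and e: "e = {x, x + gvec i}"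
    using assms by (auto simp: lattice_edges_def)
  obtain \<xi> :: "nat \<Rightarrow> 'n" where \<xi>: "bij_betw \<xi> {1..CARD('n)} UNIV" "\<xi> 1 = i"
    using ex_direction_order by blast
  have "e \<in> path_edges (perm_loop x \<xi>)"
    using first_edge_perm_loop[of x \<xi>] e \<xi>(2) by simp
  then show ?thesis
    using class_in_loops_through_iff[OF rooted_loop_perm_loop[OF x \<xi>(1)]] by blast
qed

lemma inj_on_loops_through:
  assumes "CARD('n) \<ge> 2"
  shows "inj_on loops_through (lattice_edges :: (real ^ 'n) set set)"
proof (rule inj_onI)
  fix e f :: "(real ^ 'n) set"
  assume "e \<in> lattice_edges" and f: "f \<in> lattice_edges" and eq: "loops_through e = loops_through f"
  then obtain x i where x: "x \<in> lattice_vertices" and e: "e = {x, x + gvec i}"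
    by (auto simp: lattice_edges_def)
  obtain \<xi> :: "nat \<Rightarrow> 'n" where \<xi>: "bij_betw \<xi> {1..CARD('n)} UNIV" "\<xi> 1 = i"
    using ex_direction_order by blast
  \<comment> \<open>Every loop leaving \<open>x\<close> in direction \<open>i\<close> lies in
    \<open>loops_through e\<close>, hence also traverses \<open>f\<close>.\<close>
  have "f \<subseteq> set (perm_loop x \<eta>)" if "bij_betw \<eta> {1..CARD('n)} UNIV" "\<eta> 1 = i" for \<eta>
  proof -
    note iff = class_in_loops_through_iff[OF rooted_loop_perm_loop[OF x that(1)]]
    have "e \<in> path_edges (perm_loop x \<eta>)"
      using first_edge_perm_loop[of x \<eta>] e that(2) by simp
    then have "f \<in> path_edges (perm_loop x \<eta>)"
      unfolding iff[symmetric] eq .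
    then show ?thesis
      by (rule path_edges_subset)
  qed
  from this[OF \<xi>] this[OF bij_betw_rev_tail[OF \<xi>(1)]] \<xi>(2)
  have "f \<subseteq> set (perm_loop x \<xi>) \<inter> set (perm_loop x (rev_tail \<xi>))"
    unfolding rev_tail_1 by blast
  then have "f \<subseteq> e"
    using common_vertices_rev_tail[OF \<xi>(1), of x] e \<xi>(2) by blast
  \<comment> \<open>Since \<open>f\<close> has two distinct endpoints, its inclusion in the pair
    \<open>e\<close> is an equality.\<close>
  moreover obtain y j where "f = {y, y + gvec j}"
    using f by (auto simp: lattice_edges_def)
  ultimately show "e = f"
    using gvec_nonzero[OF assms, of j] e by auto
qed

section \<open>Tilings as perfect matchings\<close>

text \<open>Covering all loops amounts to the existence of an edge of \<open>T\<close> on each loop,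
  and disjointness of the blocks to its uniqueness.\<close>

lemma tilings_iff_perfect_matching:
  fixes T :: "(real ^ 'n) set set"
  assumes "CARD('n) \<ge> 2" "T \<subseteq> lattice_edges"
  shows "T \<in> tilings \<longleftrightarrow> perfect_matching unrooted_loops hyperedges (loops_through ` T)"
proof -
  let ?U = "unrooted_loops :: (real ^ 'n) list set set"
  have inj: "loops_through e = loops_through f \<longleftrightarrow> e = f" if "e \<in> T" "f \<in> T" for e f
    using inj_on_eq_iff[OF inj_on_loops_through[OF assms(1)]] that assms(2) by blast
  have "perfect_matching ?U hyperedges (loops_through ` T)
      \<longleftrightarrow> \<Union>(loops_through ` T) = ?U \<and> disjoint (loops_through ` T)"
    using assms(2) loops_through_nonempty
    by (auto simp: perfect_matching_def partition_on_def hyperedges_def)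
  also have "\<dots> \<longleftrightarrow> (\<forall>u\<in>?U. \<exists>!e. e \<in> T \<and> traverses u e)"
  proof -
    have "\<Union>(loops_through ` T) = ?U \<longleftrightarrow> (\<forall>u\<in>?U. \<exists>e. e \<in> T \<and> traverses u e)"
      by (auto simp: loops_through_def)
    moreover have "disjoint (loops_through ` T)
        \<longleftrightarrow> (\<forall>u\<in>?U. \<forall>e f. e \<in> T \<and> traverses u e \<and> f \<in> T \<and> traverses u f \<longrightarrow> e = f)"
    proof -
      \<comment> \<open>\<open>disjoint\<close> compares distinct blocks only; injectivity turns
        these into distinct edges.\<close>
      have "disjoint (loops_through ` T)
          \<longleftrightarrow> (\<forall>e\<in>T. \<forall>f\<in>T. e \<noteq> f \<longrightarrow> loops_through e \<inter> loops_through f = {})"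
        using inj by (auto simp: pairwise_def disjnt_def)
      also have "\<dots> \<longleftrightarrow> (\<forall>e\<in>T. \<forall>f\<in>T. \<forall>u\<in>?U. traverses u e \<and> traverses u f \<longrightarrow> e = f)"
        unfolding loops_through_def by blast
      finally show ?thesis
        by blast
    qed
    moreover have "(\<exists>!e. e \<in> T \<and> traverses u e) \<longleftrightarrow> (\<exists>e. e \<in> T \<and> traverses u e)
        \<and> (\<forall>e f. e \<in> T \<and> traverses u e \<and> f \<in> T \<and> traverses u f \<longrightarrow> e = f)" for u
      by blast
    ultimately show ?thesis
      by (simp only: ball_conj_distrib)
  qed
  finally show ?thesis
    using assms(2) by (auto simp: tilings_def)
qed

theorem lemma6p3:
  fixes d :: nat
  assumes "d \<ge> 2" and "CARD('n::finite) = d + 1"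
  shows "bij_betw (\<lambda>T. {loops_through e | e. e \<in> T})
           (tilings :: (real ^ 'n) set set set)
           {M. perfect_matching unrooted_loops hyperedges M}"
proof -
  have card: "CARD('n) \<ge> 2"
    using assms by simp
  note iff = tilings_iff_perfect_matching[OF card]
  have sub: "T \<subseteq> lattice_edges" if "T \<in> tilings" for T :: "(real ^ 'n) set set"
    using that by (simp add: tilings_def)
  have "inj_on ((`) loops_through) (tilings :: (real ^ 'n) set set set)"
    using sub by (intro inj_onI) (metis inj_on_image_eq_iff[OF inj_on_loops_through[OF card]])
  moreover have "(`) loops_through ` tilings
      = {M. perfect_matching (unrooted_loops :: (real ^ 'n) list set set) hyperedges M}"
  proof (intro equalityI subsetI)
    fix M assume "M \<in> (`) loops_through ` (tilings :: (real ^ 'n) set set set)"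
    then show "M \<in> {M. perfect_matching unrooted_loops hyperedges M}"
      using iff sub by blast
  next
    fix M :: "(real ^ 'n) list set set set"
    assume "M \<in> {M. perfect_matching unrooted_loops hyperedges M}"
    then have M: "perfect_matching unrooted_loops hyperedges M"
      by simp
    \<comment> \<open>Every set of hyperedges is the image of a set of edges, to which the
      equivalence applies.\<close>
    then obtain T where "T \<subseteq> lattice_edges" "M = loops_through ` T"
      by (metis perfect_matching_def hyperedges_def subset_image_iff)
    then show "M \<in> (`) loops_through ` tilings"
      using M iff by blast
  qed
  moreover have "(`) loops_through = (\<lambda>T :: (real ^ 'n) set set. {loops_through e | e. e \<in> T})"
    by (rule ext) blast
  ultimately show ?thesis
    unfolding bij_betw_def by simp
qed

end
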